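(* $R(W_5, W_7) \ge 15$.
   Context: For graphs $G_1,G_2$, the Ramsey number $R(G_1,G_2)$ is the smallest positive integer $N$ such that every red-blue edge-coloring of $K_N$ contains a red copy of $G_1$ or a blue copy of $G_2$. The wheel $W_n$ is the graph on $n$ vertices obtained by adding a new vertex adjacent to every vertex of the cycle $C_{n-1}$. *)

theory Defs
  imports "HOL-Library.Ramsey"
begin

text \<open>An undirected simple graph is a pair of a vertex set and a set of two-element subsets of it;
  edges follow the conventions of HOL-Library.Ramsey, with \<open>[V]\<^bsup>2\<^esup>\<close> the edge set of the complete
  graph on \<open>V\<close>.\<close>

type_synonym 'a ugraph = "'a set \<times> 'a set set"

abbreviation verts :: "'a ugraph \<Rightarrow> 'a set" where "verts \<equiv> fst"
abbreviation edges :: "'a ugraph \<Rightarrow> 'a set set" where "edges \<equiv> snd"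

definition finite_simple_graph :: "'a ugraph \<Rightarrow> bool" where
  "finite_simple_graph G \<longleftrightarrow> finite (verts G) \<and> edges G \<subseteq> [verts G]\<^bsup>2\<^esup>"

text \<open>Copies are subgraphs, not necessarily induced.\<close>

definition contains_copy :: "'a ugraph \<Rightarrow> 'b ugraph \<Rightarrow> bool" where
  "contains_copy G H \<longleftrightarrow>
     (\<exists>\<phi>. inj_on \<phi> (verts H) \<and> \<phi> ` verts H \<subseteq> verts G \<and> (\<forall>e \<in> edges H. \<phi> ` e \<in> edges G))"

datatype colour = Red | Blue

definition colour_graph :: "nat \<Rightarrow> (nat set \<Rightarrow> colour) \<Rightarrow> colour \<Rightarrow> nat ugraph" where
  "colour_graph N c k = ({..<N}, {e \<in> [{..<N}]\<^bsup>2\<^esup>. c e = k})"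

text \<open>Colourings are total functions, but only their values on the edges of the complete graph on
  \<open>{..<N}\<close> matter.\<close>

definition ramsey_arrow :: "nat \<Rightarrow> 'a ugraph \<Rightarrow> 'b ugraph \<Rightarrow> bool" where
  "ramsey_arrow N G1 G2 \<longleftrightarrow>
     (\<forall>c. contains_copy (colour_graph N c Red) G1 \<or> contains_copy (colour_graph N c Blue) G2)"

definition ramsey_number :: "'a ugraph \<Rightarrow> 'b ugraph \<Rightarrow> nat" where
  "ramsey_number G1 G2 = (LEAST N. 0 < N \<and> ramsey_arrow N G1 G2)"

text \<open>Only meaningful for \<open>m \<ge> 3\<close>.\<close>

definition cycle_graph :: "nat \<Rightarrow> nat ugraph" where
  "cycle_graph m = ({..<m}, {{i, Suc i mod m} |i. i < m})"

text \<open>\<open>wheel_graph n\<close> has \<open>n\<close> vertices in total, the hub being \<open>n - 1\<close>; only meaningful for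
  \<open>n \<ge> 4\<close>.\<close>

definition wheel_graph :: "nat \<Rightarrow> nat ugraph" where
  "wheel_graph n =
     (insert (n - 1) (verts (cycle_graph (n - 1))),
      edges (cycle_graph (n - 1)) \<union> {{n - 1, v} |v. v \<in> verts (cycle_graph (n - 1))})"

lemma finite_simple_graph_wheel:
  assumes "4 \<le> n"
  shows "finite_simple_graph (wheel_graph n)" and "card (verts (wheel_graph n)) = n"
proof -
  have "Suc i mod (n - 1) \<noteq> i" if "i < n - 1" for i
    using that assms by (cases "Suc i = n - 1") auto
  moreover have "Suc i mod (n - 1) < n - 1" for i
    using assms by simp
  ultimately have "{i, Suc i mod (n - 1)} \<in> [{..<n - 1}]\<^bsup>2\<^esup>" if "i < n - 1" for i
    using that by (auto simp: nsets_def card_2_iff simp del: mod_less_divisor)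
  then show "finite_simple_graph (wheel_graph n)"
    by (auto simp: finite_simple_graph_def wheel_graph_def cycle_graph_def nsets_def subset_iff)
  show "card (verts (wheel_graph n)) = n"
    using assms by (simp add: wheel_graph_def cycle_graph_def)
qed

lemma contains_copy_clique:
  assumes "finite_simple_graph H" and "R \<subseteq> verts G" and "finite R" and "card R = card (verts H)"
    and "[R]\<^bsup>2\<^esup> \<subseteq> edges G"
  shows "contains_copy G H"
proof -
  obtain \<phi> where \<phi>: "bij_betw \<phi> (verts H) R"
    using assms finite_same_card_bij by (metis finite_simple_graph_def)
  have "\<phi> ` e \<in> [R]\<^bsup>2\<^esup>" if "e \<in> edges H" for e
  proof -
    have "e \<subseteq> verts H" "finite e" "card e = 2"
      using that assms(1) by (auto simp: finite_simple_graph_def nsets_def)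
    then show ?thesis
      using \<phi> by (auto simp: nsets_def bij_betw_def card_image inj_on_subset)
  qed
  then have "\<forall>e \<in> edges H. \<phi> ` e \<in> edges G"
    using assms(5) by (meson subsetD)
  moreover have "inj_on \<phi> (verts H)" and "\<phi> ` verts H \<subseteq> verts G"
    using \<phi> assms(2) by (simp_all add: bij_betw_def)
  ultimately show ?thesis
    unfolding contains_copy_def by (intro exI[of _ \<phi>] conjI)
qed

text \<open>The set over which \<^const>\<open>ramsey_number\<close> takes the least element is never empty.\<close>

lemma ramsey_arrow_exists:
  assumes "finite_simple_graph G1" and "finite_simple_graph G2"
  shows "\<exists>N>0. ramsey_arrow N G1 G2"
proof -
  obtain r where r: "r \<ge> 1"
    "\<And>(V :: nat set) E. finite V \<Longrightarrow> card V \<ge> r \<Longrightarrow>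
      \<exists>R \<subseteq> V. card R = card (verts G1) \<and> clique R E \<or> card R = card (verts G2) \<and> indep R E"
    using ramsey2[of "card (verts G1)" "card (verts G2)"] by metis
  have "ramsey_arrow r G1 G2"
    unfolding ramsey_arrow_def
  proof
    fix c :: "nat set \<Rightarrow> colour"
    obtain R where R: "R \<subseteq> {..<r}"
      "card R = card (verts G1) \<and> clique R {e. c e = Red} \<or>
       card R = card (verts G2) \<and> indep R {e. c e = Red}"
      using r(2)[of "{..<r}" "{e. c e = Red}"] by auto
    have fin: "finite R"
      using R(1) finite_subset by blast
    have pairs: "e \<in> [{..<r}]\<^bsup>2\<^esup> \<and> (\<exists>v w. e = {v, w} \<and> v \<in> R \<and> w \<in> R \<and> v \<noteq> w)"
      if "e \<in> [R]\<^bsup>2\<^esup>" for e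
      using that R(1) by (auto simp: nsets_def card_2_iff)
    have blue: "c e = Blue" if "c e \<noteq> Red" for e
      using that by (cases "c e") auto
    show "contains_copy (colour_graph r c Red) G1 \<or> contains_copy (colour_graph r c Blue) G2"
      using R(2)
    proof
      assume *: "card R = card (verts G1) \<and> clique R {e. c e = Red}"
      have "[R]\<^bsup>2\<^esup> \<subseteq> edges (colour_graph r c Red)"
        using pairs * by (fastforce simp: colour_graph_def clique_def)
      then show ?thesis
        using contains_copy_clique[OF assms(1), of R "colour_graph r c Red"] R(1) fin *
        by (simp add: colour_graph_def)
    next
      assume *: "card R = card (verts G2) \<and> indep R {e. c e = Red}"
      have "[R]\<^bsup>2\<^esup> \<subseteq> edges (colour_graph r c Blue)"
        using pairs * blue by (fastforce simp: colour_graph_def indep_def)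
      then show ?thesis
        using contains_copy_clique[OF assms(2), of R "colour_graph r c Blue"] R(1) fin *
        by (simp add: colour_graph_def)
    qed
  qed
  then show ?thesis
    using r(1) by (intro exI[of _ r]) simp
qed

end

theory Submission
  imports Defs
begin

text \<open>Blow up the red 5-cycle with parts \<open>A = {0,1}\<close>, \<open>B = {2,\<dots>,5}\<close>, \<open>C = {6,\<dots>,9}\<close>, \<open>D = {10,11}\<close>,
  \<open>E = {12,13}\<close>, and add a red perfect matching inside each of \<open>B\<close>, \<open>C\<close>, \<open>E\<close>.
  A red neighbourhood induces a red graph that is a matching, together with at most one vertex
  joined to everything, so it has no 4-cycle. In blue, the neighbourhood of a vertex of \<open>A\<close> (or \<open>D\<close>)
  has a cut vertex whose removal leaves components of sizes 4 and 2; that of a vertex of \<open>B\<close> (or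
  \<open>C\<close>) has 6 vertices, and removing two of them leaves three components; that of a vertex of \<open>E\<close>
  is a disjoint union of two 4-cycles. None of these contains a 6-cycle.\<close>

lemma contains_copy_mono:
  assumes "contains_copy G H" and "verts G \<subseteq> verts G'" and "edges G \<subseteq> edges G'"
  shows "contains_copy G' H"
  using assms unfolding contains_copy_def by (meson order_trans subsetD)

lemma ramsey_arrow_mono:
  assumes "ramsey_arrow M G1 G2" and "M \<le> N"
  shows "ramsey_arrow N G1 G2"
proof -
  have sub: "verts (colour_graph M c k) \<subseteq> verts (colour_graph N c k)"
    "edges (colour_graph M c k) \<subseteq> edges (colour_graph N c k)" for c k
    using assms(2) nsets_mono[of "{..<M}" "{..<N}" 2] by (auto simp: colour_graph_def)
  show ?thesis
    using assms(1) contains_copy_mono[OF _ sub] unfolding ramsey_arrow_def by metis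
qed

text \<open>By \<open>ramsey_arrow_exists\<close> the least element is attained, and by monotonicity
  in \<open>N\<close> one bad colouring on \<open>N\<close> vertices excludes every smaller order as
  well.\<close>

lemma ramsey_number_greater:
  assumes "finite_simple_graph G1" and "finite_simple_graph G2" and "\<not> ramsey_arrow N G1 G2"
  shows "N < ramsey_number G1 G2"
proof -
  have "ramsey_arrow (ramsey_number G1 G2) G1 G2"
    using LeastI_ex[OF ramsey_arrow_exists[OF assms(1,2)]] by (simp add: ramsey_number_def)
  then show ?thesis
    using ramsey_arrow_mono assms(3) by (metis not_le)
qed

lemma wheel_copy_list:
  assumes "contains_copy G (wheel_graph (Suc m))" and "0 < m"
  obtains h vs where "distinct (h # vs)" and "length vs = m" and "set (h # vs) \<subseteq> verts G"
    and "\<And>v. v \<in> set vs \<Longrightarrow> {h, v} \<in> edges G"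
    and "successively (\<lambda>x y. {x, y} \<in> edges G) vs" and "{hd vs, last vs} \<in> edges G"
proof -
  obtain \<phi> where inj: "inj_on \<phi> (insert m {..<m})" and img: "\<phi> ` insert m {..<m} \<subseteq> verts G"
    and edg: "\<And>e. e \<in> edges (wheel_graph (Suc m)) \<Longrightarrow> \<phi> ` e \<in> edges G"
    using assms(1) by (auto simp: contains_copy_def wheel_graph_def cycle_graph_def)
  have rim: "{\<phi> i, \<phi> (Suc i mod m)} \<in> edges G" if "i < m" for i
    using edg[of "{i, Suc i mod m}"] that by (auto simp: wheel_graph_def cycle_graph_def)
  have spoke: "{\<phi> m, \<phi> i} \<in> edges G" if "i < m" for i
    using edg[of "{m, i}"] that by (auto simp: wheel_graph_def cycle_graph_def)
  show thesis
  proof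
    show "distinct (\<phi> m # map \<phi> [0..<m])"
      using inj by (auto simp: distinct_map atLeast0LessThan)
    show "set (\<phi> m # map \<phi> [0..<m]) \<subseteq> verts G"
      using img by (auto simp: atLeast0LessThan)
    show "successively (\<lambda>x y. {x, y} \<in> edges G) (map \<phi> [0..<m])"
      unfolding successively_conv_nth
    proof (intro allI impI)
      fix i assume "Suc i < length (map \<phi> [0..<m])"
      then show "{map \<phi> [0..<m] ! i, map \<phi> [0..<m] ! Suc i} \<in> edges G"
        using rim[of i] by (simp add: nth_append)
    qed
    show "{hd (map \<phi> [0..<m]), last (map \<phi> [0..<m])} \<in> edges G"
      \<comment> \<open>The closing edge of the rim is the wrap-around case, where
        \<open>Suc (m - 1) mod m = 0\<close>.\<close>
      using rim[of "m - 1"] assms(2) by (simp add: hd_map last_map insert_commute)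
  qed (use spoke in auto)
qed

text \<open>Growing at the head and discarding non-adjacent extensions at once keeps the exhaustive
  search small enough to evaluate.\<close>

primrec paths :: "('a \<Rightarrow> 'a \<Rightarrow> bool) \<Rightarrow> 'a list \<Rightarrow> nat \<Rightarrow> 'a list list" where
  "paths E S 0 = [[]]"
| "paths E S (Suc k) =
     concat (map (\<lambda>p. map (\<lambda>x. x # p) (filter (\<lambda>x. x \<notin> set p \<and> (p = [] \<or> E x (hd p))) S))
       (paths E S k))"

lemma paths_complete:
  assumes "distinct vs" and "set vs \<subseteq> set S" and "successively E vs"
  shows "vs \<in> set (paths E S (length vs))"
  using assms by (induction vs) (auto simp: successively_Cons)

text \<open>Here \<open>m\<close> is the rim length. The test \<open>v \<noteq> h\<close> matters
  for blue: the complement of \<open>red_adj\<close> relates each vertex to itself.\<close>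

definition wheel_free :: "('a \<Rightarrow> 'a \<Rightarrow> bool) \<Rightarrow> 'a list \<Rightarrow> nat \<Rightarrow> bool" where
  "wheel_free E V m \<longleftrightarrow>
     (\<forall>h \<in> set V. \<forall>p \<in> set (paths E (filter (\<lambda>v. v \<noteq> h \<and> E h v) V) m). \<not> E (hd p) (last p))"

lemma wheel_free_no_copy:
  assumes "wheel_free E V m" and "0 < m" and "verts G \<subseteq> set V"
    and adj: "\<And>x y. {x, y} \<in> edges G \<Longrightarrow> E x y"
  shows "\<not> contains_copy G (wheel_graph (Suc m))"
proof
  assume "contains_copy G (wheel_graph (Suc m))"
  then obtain h vs where vs: "distinct (h # vs)" "length vs = m" "set (h # vs) \<subseteq> verts G"
    "\<And>v. v \<in> set vs \<Longrightarrow> {h, v} \<in> edges G"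
    "successively (\<lambda>x y. {x, y} \<in> edges G) vs" "{hd vs, last vs} \<in> edges G"
    using wheel_copy_list assms(2) by metis
  have "successively E vs"
    using vs(5) adj by (auto simp: successively_conv_nth)
  moreover have "set vs \<subseteq> set (filter (\<lambda>v. v \<noteq> h \<and> E h v) V)"
    using vs(1,3,4) adj assms(3) by auto
  ultimately have "vs \<in> set (paths E (filter (\<lambda>v. v \<noteq> h \<and> E h v) V) m)"
    using paths_complete[of vs _ E] vs(1,2) by simp
  moreover have "h \<in> set V"
    using vs(3) assms(3) by auto
  ultimately have "\<not> E (hd vs) (last vs)"
    using assms(1) unfolding wheel_free_def by blast
  then show False
    using vs(6) adj by blast
qed

text \<open>Adjacency lists, one row of text per part \<open>A\<close> to \<open>E\<close>; the
  matching edges are 2-3, 4-5, 6-7, 8-9 and 12-13.\<close>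

definition red_adj :: "nat \<Rightarrow> nat \<Rightarrow> bool" where
  "red_adj x y \<longleftrightarrow> y \<in> set (
     [[2,3,4,5,12,13], [2,3,4,5,12,13],
      [0,1,3,6,7,8,9], [0,1,2,6,7,8,9], [0,1,5,6,7,8,9], [0,1,4,6,7,8,9],
      [2,3,4,5,7,10,11], [2,3,4,5,6,10,11], [2,3,4,5,9,10,11], [2,3,4,5,8,10,11],
      [6,7,8,9,12,13], [6,7,8,9,12,13],
      [0,1,10,11,13], [0,1,10,11,12]] ! x)"

lemma wheel_free_red: "wheel_free red_adj [0..<14] 4"
  by code_simp

lemma wheel_free_blue: "wheel_free (\<lambda>x y. \<not> red_adj x y) [0..<14] 6"
  by code_simp

lemma red_adj_sym: "\<forall>x\<in>set [0..<14]. \<forall>y\<in>set [0..<14]. red_adj x y \<longrightarrow> red_adj y x"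
  by code_simp

lemma not_ramsey_arrow_14: "\<not> ramsey_arrow 14 (wheel_graph 5) (wheel_graph 7)"
proof -
  define c where "c e = (if \<exists>x y. e = {x, y} \<and> red_adj x y then Red else Blue)" for e
  have edge: "x < 14 \<and> y < 14 \<and> c {x, y} = k" if "{x, y} \<in> edges (colour_graph 14 c k)" for x y k
    using that by (auto simp: colour_graph_def nsets_def)
  \<comment> \<open>An unordered red edge yields \<open>red_adj\<close> in one of the two orders
    only; symmetry supplies the other.\<close>
  have red: "red_adj x y" if "{x, y} \<in> edges (colour_graph 14 c Red)" for x y
    using edge[OF that] red_adj_sym by (auto simp: c_def doubleton_eq_iff split: if_splits)
  have blue: "\<not> red_adj x y" if "{x, y} \<in> edges (colour_graph 14 c Blue)" for x y
    using edge[OF that] by (auto simp: c_def split: if_splits)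
  have "\<not> contains_copy (colour_graph 14 c Red) (wheel_graph (Suc 4))"
    by (rule wheel_free_no_copy[OF wheel_free_red _ _ red]) (auto simp: colour_graph_def)
  moreover have "\<not> contains_copy (colour_graph 14 c Blue) (wheel_graph (Suc 6))"
    by (rule wheel_free_no_copy[OF wheel_free_blue _ _ blue]) (auto simp: colour_graph_def)
  ultimately show ?thesis
    unfolding ramsey_arrow_def by auto
qed

theorem theorem6:
  shows "ramsey_number (wheel_graph 5) (wheel_graph 7) \<ge> 15"
  using ramsey_number_greater[OF _ _ not_ramsey_arrow_14] finite_simple_graph_wheel(1) by force

end
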